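(* Let $\Gamma$ be a countably infinite discrete group acting continuously on a compact metrizable space $X$. The following are equivalent: (1) $h^{\rm nv}(\Gamma\curvearrowright X)>0$; (2) there is a finite pairwise disjoint closed $\mathcal A\subseteq\mathscr A_2$ with positive independence density; (3) there is a finite pairwise disjoint closed $\mathcal A\subseteq\mathscr A_{\ge 2}$ with positive independence density.
   Context: Naive topological entropy: for a finite open cover $\mathcal U$ of $X$, $N(\mathcal U)$ is the minimal cardinality of subcovers of $\mathcal U$. For covers $\mathcal U,\mathcal V$, $\mathcal U\vee\mathcal V=\{U\cap V: U\in\mathcal U, V\in\mathcal V\}$. For a nonempty finite $F\subseteq\Gamma$, $\mathcal U^F=\bigvee_{s\in F}s^{-1}\mathcal U$. Set $h^{\rm nv}(\Gamma,\mathcal U)=\inf_F\frac{1}{|F|}\log N(\mathcal U^F)$, with $F$ ranging over nonempty finite subsets of $\Gamma$, and $h^{\rm nv}(\Gamma\curvearrowright X)=\sup_{\mathcal U}h^{\rm nv}(\Gamma,\mathcal U)$, with $\mathcal U$ ranging over finite open covers of $X$. Tuples and independence: $[k]=\{1,\dots,k\}$. For $k\in\mathbb N=\{1,2,\dots\}$, $\mathscr A_k$ is the set of all $k$-tuples of subsets of $X$; $\mathscr A_{\ge m}=\bigcup_{k\ge m}\mathscr A_k$ and $\mathscr A=\mathscr A_{\ge 1}$. For $\mathbf A=(A_1,\dots,A_k)\in\mathscr A$, a set $J\subseteq\Gamma$ is an independence set for $\mathbf A$ if for any nonempty finite $F\subseteq J$ and any map $\omega:F\to[k]$ one has $\bigcap_{s\in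 F}s^{-1}A_{\omega(s)}\neq\emptyset$. For finite $\mathcal A\subseteq\mathscr A$, the independence density of $\mathcal A$ is the largest $q\ge 0$ such that for every nonempty finite $F\subseteq\Gamma$ there are some $J\subseteq F$ with $|J|\ge q|F|$ and some $\mathbf A\in\mathcal A$ such that $J$ is an independence set for $\mathbf A$. A tuple $(A_1,\dots,A_k)$ is pairwise disjoint (resp. closed) if the sets $A_1,\dots,A_k$ are pairwise disjoint (resp. closed in $X$). A family $\mathcal A\subseteq\mathscr A$ is pairwise disjoint (resp. closed) if each $\mathbf A\in\mathcal A$ is pairwise disjoint (resp. closed). *)

theory Defs
  imports "HOL-Analysis.Analysis" "HOL-Algebra.Group_Action"
begin

section \<open>Continuous actions of discrete groups\<close>

text \<open>The library locale \<open>group_action\<close> describes a left action of \<open>G\<close> as a homomorphism into the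
  group of bijections of the underlying set; the maps \<open>\<phi> g\<close> are \<open>undefined\<close> outside of that set.\<close>

definition continuous_action ::
  "('g, 'b) monoid_scheme \<Rightarrow> 'x topology \<Rightarrow> ('g \<Rightarrow> 'x \<Rightarrow> 'x) \<Rightarrow> bool"
  where "continuous_action G X \<phi> \<longleftrightarrow>
    group_action G (topspace X) \<phi> \<and>
    continuous_map (prod_topology (discrete_topology (carrier G)) X) X (\<lambda>(g, x). \<phi> g x)"

definition inv_translate ::
  "('g, 'b) monoid_scheme \<Rightarrow> ('g \<Rightarrow> 'x \<Rightarrow> 'x) \<Rightarrow> 'g \<Rightarrow> 'x set \<Rightarrow> 'x set"
  where "inv_translate G \<phi> s A = \<phi> (inv\<^bsub>G\<^esub> s) ` A"


section \<open>Naive topological entropy\<close>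

definition finite_open_cover :: "'x topology \<Rightarrow> 'x set set \<Rightarrow> bool"
  where "finite_open_cover X \<U> \<longleftrightarrow>
    finite \<U> \<and> (\<forall>U\<in>\<U>. openin X U) \<and> \<Union>\<U> = topspace X"

definition min_subcover_card :: "'x topology \<Rightarrow> 'x set set \<Rightarrow> nat"
  where "min_subcover_card X \<U> =
    (LEAST n. \<exists>\<V>. \<V> \<subseteq> \<U> \<and> finite \<V> \<and> \<Union>\<V> = topspace X \<and> card \<V> = n)"

definition cover_join :: "'x set set \<Rightarrow> 'x set set \<Rightarrow> 'x set set"
  where "cover_join \<U> \<V> = {U \<inter> V | U V. U \<in> \<U> \<and> V \<in> \<V>}"

text \<open>The join of a family of covers indexed by a nonempty finite set; the two lemmas below
  say that this is the iterated binary join.\<close>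

definition Cover_Join :: "'i set \<Rightarrow> ('i \<Rightarrow> 'x set set) \<Rightarrow> 'x set set"
  where "Cover_Join F \<W> = {(\<Inter>s\<in>F. W s) | W. \<forall>s\<in>F. W s \<in> \<W> s}"

lemma Cover_Join_singleton: "Cover_Join {s} \<W> = \<W> s"
  by (force simp: Cover_Join_def)

lemma Cover_Join_insert:
  assumes "s \<notin> F"
  shows "Cover_Join (insert s F) \<W> = cover_join (\<W> s) (Cover_Join F \<W>)"
proof
  show "Cover_Join (insert s F) \<W> \<subseteq> cover_join (\<W> s) (Cover_Join F \<W>)"
    by (fastforce simp: Cover_Join_def cover_join_def)
  show "cover_join (\<W> s) (Cover_Join F \<W>) \<subseteq> Cover_Join (insert s F) \<W>"
  proof
    fix B assume "B \<in> cover_join (\<W> s) (Cover_Join F \<W>)"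
    then obtain U W where U: "U \<in> \<W> s" and W: "\<forall>t\<in>F. W t \<in> \<W> t"
      and B: "B = U \<inter> (\<Inter>t\<in>F. W t)"
      by (auto simp: Cover_Join_def cover_join_def)
    have "B = (\<Inter>t\<in>insert s F. (W(s := U)) t)"
      using B assms by auto
    moreover have "\<forall>t\<in>insert s F. (W(s := U)) t \<in> \<W> t"
      using U W by auto
    ultimately show "B \<in> Cover_Join (insert s F) \<W>"
      unfolding Cover_Join_def by blast
  qed
qed

definition iterated_cover ::
  "('g, 'b) monoid_scheme \<Rightarrow> ('g \<Rightarrow> 'x \<Rightarrow> 'x) \<Rightarrow> 'x set set \<Rightarrow> 'g set \<Rightarrow> 'x set set"
  where "iterated_cover G \<phi> \<U> F = Cover_Join F (\<lambda>s. inv_translate G \<phi> s ` \<U>)"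

text \<open>The naive entropy may be infinite, so it takes values in \<open>ereal\<close>. For the empty space the number
  of sets in a minimal subcover is \<open>0\<close>, and the convention \<open>ln 0 = 0\<close> makes the entropy \<open>0\<close>.\<close>

definition naive_entropy_cover ::
  "('g, 'b) monoid_scheme \<Rightarrow> 'x topology \<Rightarrow> ('g \<Rightarrow> 'x \<Rightarrow> 'x) \<Rightarrow> 'x set set \<Rightarrow> ereal"
  where "naive_entropy_cover G X \<phi> \<U> =
    (INF F \<in> {F. F \<subseteq> carrier G \<and> finite F \<and> F \<noteq> {}}.
       ereal (1 / real (card F) * ln (real (min_subcover_card X (iterated_cover G \<phi> \<U> F)))))"

definition naive_entropy ::
  "('g, 'b) monoid_scheme \<Rightarrow> 'x topology \<Rightarrow> ('g \<Rightarrow> 'x \<Rightarrow> 'x) \<Rightarrow> ereal"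
  where "naive_entropy G X \<phi> = (SUP \<U> \<in> {\<U>. finite_open_cover X \<U>}. naive_entropy_cover G X \<phi> \<U>)"


section \<open>Tuples of subsets and independence\<close>

text \<open>A \<open>k\<close>-tuple of subsets of \<open>X\<close> is a list of length \<open>k\<close>, with entries numbered from \<open>0\<close>.\<close>

definition set_tuples :: "'x topology \<Rightarrow> nat \<Rightarrow> 'x set list set"
  where "set_tuples X k = {A. length A = k \<and> (\<forall>i<k. A ! i \<subseteq> topspace X)}"

definition set_tuples_ge :: "'x topology \<Rightarrow> nat \<Rightarrow> 'x set list set"
  where "set_tuples_ge X m = (\<Union>k\<in>{m..}. set_tuples X k)"

definition independence_set ::
  "('g, 'b) monoid_scheme \<Rightarrow> ('g \<Rightarrow> 'x \<Rightarrow> 'x) \<Rightarrow> 'x set list \<Rightarrow> 'g set \<Rightarrow> bool"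
  where "independence_set G \<phi> A J \<longleftrightarrow> J \<subseteq> carrier G \<and>
    (\<forall>F \<omega>. finite F \<and> F \<noteq> {} \<and> F \<subseteq> J \<and> \<omega> \<in> F \<rightarrow> {..<length A} \<longrightarrow>
      (\<Inter>s\<in>F. inv_translate G \<phi> s (A ! \<omega> s)) \<noteq> {})"

definition density_bound ::
  "('g, 'b) monoid_scheme \<Rightarrow> ('g \<Rightarrow> 'x \<Rightarrow> 'x) \<Rightarrow> 'x set list set \<Rightarrow> real \<Rightarrow> bool"
  where "density_bound G \<phi> \<A> q \<longleftrightarrow> q \<ge> 0 \<and>
    (\<forall>F. F \<subseteq> carrier G \<and> finite F \<and> F \<noteq> {} \<longrightarrow>
      (\<exists>J A. J \<subseteq> F \<and> real (card J) \<ge> q * real (card F) \<and> A \<in> \<A> \<and> independence_set G \<phi> A J))"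

text \<open>No \<open>q\<close> qualifies for the empty family, which is given density \<open>0\<close>. For every other family
  the largest \<open>q\<close> exists (lemma \<open>independence_density_greatest\<close>).\<close>

definition independence_density ::
  "('g, 'b) monoid_scheme \<Rightarrow> ('g \<Rightarrow> 'x \<Rightarrow> 'x) \<Rightarrow> 'x set list set \<Rightarrow> real"
  where "independence_density G \<phi> \<A> =
    (if \<A> = {} then 0 else (GREATEST q. density_bound G \<phi> \<A> q))"

definition pairwise_disjoint_family :: "'x set list set \<Rightarrow> bool"
  where "pairwise_disjoint_family \<A> \<longleftrightarrow>
    (\<forall>A\<in>\<A>. disjoint_family_on (\<lambda>i. A ! i) {..<length A})"

definition closed_family :: "'x topology \<Rightarrow> 'x set list set \<Rightarrow> bool"
  where "closed_family X \<A> \<longleftrightarrow> (\<forall>A\<in>\<A>. \<forall>i<length A. closedin X (A ! i))"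

lemma independence_density_greatest:
  assumes "group G" "\<A> \<noteq> {}"
  shows "density_bound G \<phi> \<A> (independence_density G \<phi> \<A>)"
    and "density_bound G \<phi> \<A> q \<Longrightarrow> q \<le> independence_density G \<phi> \<A>"
proof -
  let ?Q = "{q. density_bound G \<phi> \<A> q}"
  have zero: "0 \<in> ?Q"
    using assms(2) unfolding density_bound_def independence_set_def by fastforce
  have one: "\<one>\<^bsub>G\<^esub> \<in> carrier G"
    using assms(1) by (simp add: group.is_monoid monoid.one_closed)
  have le1: "q \<le> 1" if q: "q \<in> ?Q" for q
  proof -
    have "{\<one>\<^bsub>G\<^esub>} \<subseteq> carrier G \<and> finite {\<one>\<^bsub>G\<^esub>} \<and> {\<one>\<^bsub>G\<^esub>} \<noteq> {}"
      using one by simp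
    then obtain J where "J \<subseteq> {\<one>\<^bsub>G\<^esub>}" "real (card J) \<ge> q * real (card {\<one>\<^bsub>G\<^esub>})"
      using q unfolding density_bound_def mem_Collect_eq by meson
    moreover from this have "card J \<le> 1"
      using card_mono[of "{\<one>\<^bsub>G\<^esub>}" J] by simp
    ultimately show ?thesis by simp
  qed
  have bdd: "bdd_above ?Q"
    using le1 by (auto simp: bdd_above_def)
  define p where "p = Sup ?Q"
  have upper: "q \<le> p" if "q \<in> ?Q" for q
    unfolding p_def using that bdd by (rule cSup_upper)
  have attained: "density_bound G \<phi> \<A> p"
    unfolding density_bound_def
  proof (intro conjI allI impI)
    show "0 \<le> p" using upper zero by blast
  next
    fix F assume F: "F \<subseteq> carrier G \<and> finite F \<and> F \<noteq> {}"
    define S where "S = {card J | J A. J \<subseteq> F \<and> A \<in> \<A> \<and> independence_set G \<phi> A J}"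
    have cF: "real (card F) > 0" using F by (simp add: card_gt_0_iff)
    have "S \<subseteq> {..card F}" using F by (auto simp: S_def card_mono)
    then have fin: "finite S" using finite_subset by blast
    have bound: "q * real (card F) \<le> real (Max S)" if "q \<in> ?Q" for q
    proof -
      obtain J A where J: "J \<subseteq> F" "real (card J) \<ge> q * real (card F)" "A \<in> \<A>"
        "independence_set G \<phi> A J"
        using \<open>q \<in> ?Q\<close> F unfolding density_bound_def mem_Collect_eq by meson
      then have "card J \<in> S" unfolding S_def by blast
      then have "card J \<le> Max S" using fin by simp
      with J(2) show ?thesis by linarith
    qed
    have "S \<noteq> {}"
      using zero F unfolding S_def density_bound_def by blast
    then have "Max S \<in> S" using fin by simp
    then obtain J A where JA: "J \<subseteq> F" "A \<in> \<A>" "independence_set G \<phi> A J" "card J = Max S"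
      unfolding S_def by force
    have "p \<le> real (Max S) / real (card F)"
      unfolding p_def using zero bound cF by (intro cSup_least) (auto simp: field_simps)
    then have "p * real (card F) \<le> real (card J)"
      using cF JA(4) by (simp add: field_simps)
    then show "\<exists>J A. J \<subseteq> F \<and> p * real (card F) \<le> real (card J) \<and> A \<in> \<A> \<and> independence_set G \<phi> A J"
      using JA by blast
  qed
  have eq: "independence_density G \<phi> \<A> = p"
    using assms(2) attained upper by (auto simp: independence_density_def intro!: Greatest_equality)
  show "density_bound G \<phi> \<A> (independence_density G \<phi> \<A>)"
    using attained eq by simp
  show "density_bound G \<phi> \<A> q \<Longrightarrow> q \<le> independence_density G \<phi> \<A>"
    using upper eq by simp
qed

end

theory Submission
  imports Defs
begin

text \<open>Positive density gives positive entropy because the complements of the first two entries of a disjoint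
  tuple cover \<open>X\<close>, and along an independence set \<open>J\<close> this cover needs \<open>2 ^ card J\<close> sets.

  Conversely, let \<open>\<U>\<close> be a cover of positive entropy, and choose finitely many pairs of a closed set
  \<open>C\<close> and some \<open>U \<supseteq> C\<close> in \<open>\<U>\<close> such that the sets \<open>C\<close> cover \<open>X\<close>. The two-element covers by \<open>U\<close> and
  the complement of \<open>C\<close> then have a join refining \<open>\<U>\<close>, so that over every finite \<open>F\<close> one of them needs
  exponentially many sets. For the disjoint closed pair formed by \<open>C\<close> and the complement of \<open>U\<close>, the points
  of \<open>X\<close> are partial 0-1-valued functions on \<open>F\<close>, the members of the iterated two-element cover are
  total functions extending them, and a shattered set is an independence set. A Sauer-Shelah type
  lemma for partial functions produces a shattered set of size proportional to \<open>F\<close>.\<close>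

section \<open>Shattering for pairs of sets\<close>

text \<open>The pattern \<open>\<omega>\<close> is total on the index type because only its values
  on \<open>J\<close> matter. The set \<open>Y\<close> of admissible points is a parameter since the
  induction passes to parts of it.\<close>

definition shatters :: "('i \<Rightarrow> bool \<Rightarrow> 'x set) \<Rightarrow> 'x set \<Rightarrow> 'i set \<Rightarrow> bool"
  where "shatters A Y J \<longleftrightarrow> (\<forall>\<omega>. \<exists>x\<in>Y. \<forall>s\<in>J. x \<in> A s (\<omega> s))"

lemma shatters_mono: "shatters A Y J \<Longrightarrow> Y \<subseteq> Z \<Longrightarrow> shatters A Z J"
  unfolding shatters_def by blast

lemma shatters_empty [simp]: "shatters A Y {} \<longleftrightarrow> Y \<noteq> {}"
  unfolding shatters_def by blast

text \<open>The value of a pattern at \<open>i\<close> selects the half of \<open>Y\<close> in which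
  its restriction to \<open>J\<close> is realized.\<close>

lemma shatters_insert:
  assumes "shatters A (Y \<inter> A i True) J" "shatters A (Y \<inter> A i False) J"
  shows "shatters A Y (insert i J)"
  unfolding shatters_def
proof
  fix \<omega> :: "'a \<Rightarrow> bool"
  have "shatters A (Y \<inter> A i (\<omega> i)) J" using assms by (cases "\<omega> i") auto
  then obtain x where "x \<in> Y \<inter> A i (\<omega> i)" "\<forall>s\<in>J. x \<in> A s (\<omega> s)"
    unfolding shatters_def by blast
  then show "\<exists>x\<in>Y. \<forall>s\<in>insert i J. x \<in> A s (\<omega> s)" by blast
qed

text \<open>The counting step of Pajor's form of the Sauer-Shelah lemma: a set shattered by either
  half is shattered by \<open>Y\<close>, and one shattered by both halves counts twice, as
  \<open>J\<close> and as \<open>insert i J\<close>.\<close>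

lemma card_shattered_insert:
  assumes "finite F" "i \<notin> F"
  shows "card {J. J \<subseteq> F \<and> shatters A (Y \<inter> A i True) J} + card {J. J \<subseteq> F \<and> shatters A (Y \<inter> A i False) J}
    \<le> card {J. J \<subseteq> insert i F \<and> shatters A Y J}"
proof -
  define P where "P b = {J. J \<subseteq> F \<and> shatters A (Y \<inter> A i b) J}" for b
  have fin: "finite (P b)" for b
    unfolding P_def using assms(1) by simp
  have inj: "inj_on (insert i) (P True \<inter> P False)"
    using assms(2) unfolding inj_on_def P_def by (metis (no_types, lifting) IntE insert_ident mem_Collect_eq subsetD)
  have "card (P True) + card (P False) = card (P True \<union> P False) + card (P True \<inter> P False)"
    using fin by (intro card_Un_Int) auto
  also have "\<dots> = card (P True \<union> P False) + card (insert i ` (P True \<inter> P False))"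
    using inj by (simp add: card_image)
  also have "\<dots> = card ((P True \<union> P False) \<union> insert i ` (P True \<inter> P False))"
    using fin assms(2) by (intro card_Un_disjoint[symmetric]) (auto simp: P_def)
  also have "\<dots> \<le> card {J. J \<subseteq> insert i F \<and> shatters A Y J}"
  proof (rule card_mono)
    show "finite {J. J \<subseteq> insert i F \<and> shatters A Y J}" using assms(1) by simp
    show "(P True \<union> P False) \<union> insert i ` (P True \<inter> P False) \<subseteq> {J. J \<subseteq> insert i F \<and> shatters A Y J}"
      unfolding P_def using shatters_insert[of A Y i] by (auto intro: shatters_mono)
  qed
  finally show ?thesis unfolding P_def .
qed

text \<open>Pascal's rule summed over \<open>j\<close>. The two sums are the allowances after a
  correct and after a wrong prediction at the new coordinate.\<close>

lemma sum_choose_Suc: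
  "(\<Sum>j<Suc k. Suc n choose j) = (\<Sum>j<Suc k. n choose j) + (\<Sum>j<k. n choose j)"
  by (simp only: sum.lessThan_Suc_shift binomial_Suc_Suc sum.distrib) simp

text \<open>A point \<open>x\<close> is regarded as a partial 0-1-valued function on \<open>F\<close>, with value \<open>b\<close> at \<open>i\<close>
  if \<open>x \<in> A i b\<close>; the lemma bounds the number of total functions needed to extend all of them.
  Reveal the coordinates one by one and predict the value whose complement leaves fewer shattered
  sets: every wrong prediction halves their number, so there are fewer than \<open>k\<close> mistakes, and the
  set of mistakes determines a total function.\<close>

lemma disambiguation:
  assumes "finite F" "\<forall>i\<in>F. A i True \<inter> A i False = {}"
    and "card {J. J \<subseteq> F \<and> shatters A Y J} < 2 ^ k"
  shows "\<exists>S. finite S \<and> card S \<le> (\<Sum>j<k. card F choose j) \<and> (\<forall>x\<in>Y. \<exists>\<sigma>\<in>S. \<forall>i\<in>F. x \<notin> A i (\<not> \<sigma> i))"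
  using assms
proof (induction F arbitrary: Y k rule: finite_induct)
  case empty
  show ?case
  proof (cases k)
    case 0
    then have "{J. J = {} \<and> shatters A Y J} = {}" using empty by simp
    \<comment> \<open>Even the empty set is not shattered, so there is no point to serve.\<close>
    then have "Y = {}" using shatters_empty[of A Y] by blast
    then show ?thesis by (intro exI[of _ "{}"]) auto
  next
    case (Suc k')
    \<comment> \<open>The term for \<open>j = 0\<close> pays for the one function needed on an empty
      domain.\<close>
    have "(\<Sum>j<k. card {} choose j) \<ge> 1"
      unfolding Suc sum.lessThan_Suc_shift by simp
    then show ?thesis by (intro exI[of _ "{\<lambda>_. True}"]) auto
  qed
next
  case (insert i F)
  show ?case
  proof (cases k)
    case 0
    then have "{J. J \<subseteq> insert i F \<and> shatters A Y J} = {}"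
      using insert.prems(2) insert.hyps(1) by simp
    then have "Y = {}" using shatters_empty[of A Y] by blast
    then show ?thesis by (intro exI[of _ "{}"]) auto
  next
    case (Suc k')
    have "card {J. J \<subseteq> F \<and> shatters A (Y \<inter> A i True) J}
        + card {J. J \<subseteq> F \<and> shatters A (Y \<inter> A i False) J} < 2 * 2 ^ k'"
      using card_shattered_insert[OF insert.hyps, of A Y] insert.prems(2) Suc by simp
    then have "card {J. J \<subseteq> F \<and> shatters A (Y \<inter> A i True) J} < 2 ^ k' \<or>
        card {J. J \<subseteq> F \<and> shatters A (Y \<inter> A i False) J} < 2 ^ k'"
      by linarith
    then obtain m where m: "card {J. J \<subseteq> F \<and> shatters A (Y \<inter> A i (\<not> m)) J} < 2 ^ k'"
      using that[of False] that[of True] by auto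
    have "card {J. J \<subseteq> F \<and> shatters A Y J} \<le> card {J. J \<subseteq> insert i F \<and> shatters A Y J}"
      using insert.hyps(1) by (intro card_mono) auto
    then have less: "card {J. J \<subseteq> F \<and> shatters A Y J} < 2 ^ k"
      using insert.prems(2) by linarith
    have disj: "\<forall>j\<in>F. A j True \<inter> A j False = {}"
      using insert.prems(1) by simp
    \<comment> \<open>\<open>S1\<close> serves the points that do not contradict the prediction
      \<open>m\<close>, including those without a value at \<open>i\<close>, and keeps the full
      budget \<open>k\<close>. \<open>S2\<close> serves the points with value
      \<open>\<not> m\<close>, where the mistake has reduced the budget to
      \<open>k'\<close>.\<close>
    obtain S1 where S1: "finite S1" "card S1 \<le> (\<Sum>j<k. card F choose j)"
        "\<forall>x\<in>Y. \<exists>\<sigma>\<in>S1. \<forall>i\<in>F. x \<notin> A i (\<not> \<sigma> i)"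
      using insert.IH[OF disj less] by (elim exE conjE) (rule that)
    obtain S2 where S2: "finite S2" "card S2 \<le> (\<Sum>j<k'. card F choose j)"
        "\<forall>x\<in>Y \<inter> A i (\<not> m). \<exists>\<sigma>\<in>S2. \<forall>i\<in>F. x \<notin> A i (\<not> \<sigma> i)"
      using insert.IH[OF disj m] by (elim exE conjE) (rule that)
    define S where "S = (\<lambda>\<sigma>. \<sigma>(i := m)) ` S1 \<union> (\<lambda>\<sigma>. \<sigma>(i := \<not> m)) ` S2"
    have "card S \<le> card S1 + card S2"
      unfolding S_def using card_Un_le card_image_le[OF S1(1)] card_image_le[OF S2(1)]
      by (meson add_mono order_trans)
    also have "\<dots> \<le> (\<Sum>j<k. card (insert i F) choose j)"
      using S1(2) S2(2) insert.hyps sum_choose_Suc[of "card F" k'] Suc by simp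
    finally have "card S \<le> (\<Sum>j<k. card (insert i F) choose j)" .
    moreover have "\<exists>\<sigma>\<in>S. \<forall>j\<in>insert i F. x \<notin> A j (\<not> \<sigma> j)" if x: "x \<in> Y" for x
    proof (cases "x \<in> A i (\<not> m)")
      case False
      obtain \<sigma> where "\<sigma> \<in> S1" "\<forall>j\<in>F. x \<notin> A j (\<not> \<sigma> j)" using S1(3) x by blast
      with False insert.hyps(2) show ?thesis
        unfolding S_def by (intro bexI[of _ "\<sigma>(i := m)"]) auto
    next
      case True
      then have "x \<notin> A i m" using insert.prems(1) by (cases m) auto
      moreover obtain \<sigma> where "\<sigma> \<in> S2" "\<forall>j\<in>F. x \<notin> A j (\<not> \<sigma> j)" using S2(3) x True by blast
      ultimately show ?thesis using insert.hyps(2)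
        unfolding S_def by (intro bexI[of _ "\<sigma>(i := \<not> m)"]) auto
    qed
    ultimately show ?thesis using S1(1) S2(1) unfolding S_def by (intro exI[of _ S]) (auto simp: S_def)
  qed
qed

section \<open>Exponential bounds for binomial sums and for extending functions\<close>

text \<open>A Chernoff-type argument: weighting the terms by \<open>t ^ j\<close> with
  \<open>t < 1\<close> bounds the sum by \<open>(t + 1) ^ n\<close>, and on the given range the
  weight is at least \<open>t powr (\<delta> * n)\<close>.\<close>

lemma sum_choose_le_exp:
  assumes "\<epsilon> > (0::real)"
  obtains \<delta> where "\<delta> > 0"
    "\<And>n. real (\<Sum>j | j \<le> n \<and> real j \<le> \<delta> * real n. n choose j) \<le> exp (\<epsilon> * real n)"
proof -
  \<comment> \<open>Half of the exponent \<open>\<epsilon>\<close> pays for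
    \<open>(t + 1) ^ n \<le> exp (t * n)\<close>; the bound \<open>1/2\<close> keeps
    \<open>ln t\<close> negative.\<close>
  define t where "t = min (1/2) (\<epsilon>/2)"
  have t: "0 < t" "t < 1" "t \<le> \<epsilon>/2" using assms by (auto simp: t_def)
  have lnt: "ln t < 0" using t by simp
  \<comment> \<open>Chosen so that removing the weight costs exactly the other half of the
    exponent.\<close>
  define \<delta> where "\<delta> = (\<epsilon>/2) / (- ln t)"
  have \<delta>: "\<delta> > 0" using assms lnt by (simp add: \<delta>_def divide_pos_neg)
  have dl: "\<delta> * ln t = - \<epsilon>/2" using lnt by (simp add: \<delta>_def)
  have "real (\<Sum>j | j \<le> n \<and> real j \<le> \<delta> * real n. n choose j) \<le> exp (\<epsilon> * real n)" for n
  proof -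
    let ?I = "{j. j \<le> n \<and> real j \<le> \<delta> * real n}"
    define T where "T = t powr (\<delta> * real n)"
    have Tp: "T > 0" using t by (simp add: T_def)
    have "\<delta> * real n * ln t = (\<delta> * ln t) * real n" by simp
    then have T: "T = exp (- (\<epsilon>/2) * real n)"
      using t dl by (simp add: T_def powr_def)
    have "T * real (\<Sum>j\<in>?I. n choose j) = (\<Sum>j\<in>?I. T * real (n choose j))"
      by (simp add: sum_distrib_left)
    also have "\<dots> \<le> (\<Sum>j\<in>?I. real (n choose j) * t ^ j)"
    proof (rule sum_mono)
      fix j assume "j \<in> ?I"
      then have "T \<le> t powr real j" unfolding T_def using t by (intro powr_mono') auto
      then have "T \<le> t ^ j" using t by (simp add: powr_realpow)
      then have "real (n choose j) * T \<le> real (n choose j) * t ^ j"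
        by (rule mult_left_mono) simp
      then show "T * real (n choose j) \<le> real (n choose j) * t ^ j"
        by (simp only: mult.commute)
    qed
    also have "\<dots> \<le> (\<Sum>j\<le>n. real (n choose j) * t ^ j)"
      using t by (intro sum_mono2) auto
    also have "\<dots> = (t + 1) ^ n" by (simp add: binomial_ring)
    also have "\<dots> \<le> exp t ^ n"
      using t exp_ge_add_one_self[of t] by (intro power_mono) (auto simp: add.commute)
    also have "\<dots> = exp (t * real n)" by (simp add: exp_of_nat2_mult)
    also have "\<dots> \<le> exp ((\<epsilon>/2) * real n)" using mult_right_mono[OF t(3), of "real n"] by simp
    also have "\<dots> = T * exp (\<epsilon> * real n)" unfolding T by (simp add: exp_add[symmetric] field_simps)
    finally show ?thesis using Tp by simp
  qed
  with \<delta> show ?thesis by (rule that)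
qed

lemma card_subsets_le:
  assumes "finite F"
  shows "card {J. J \<subseteq> F \<and> real (card J) \<le> r} \<le> (\<Sum>j | j \<le> card F \<and> real j \<le> r. card F choose j)"
proof -
  let ?I = "{j. j \<le> card F \<and> real j \<le> r}"
  have "{J. J \<subseteq> F \<and> real (card J) \<le> r} = (\<Union>j\<in>?I. {J. J \<subseteq> F \<and> card J = j})"
    using assms by (auto simp: card_mono)
  then have "card {J. J \<subseteq> F \<and> real (card J) \<le> r} \<le> (\<Sum>j\<in>?I. card {J. J \<subseteq> F \<and> card J = j})"
    by (simp add: card_UN_le)
  then show ?thesis using assms by (simp add: n_subsets)
qed

text \<open>The binomial estimate enters twice: small sets are few, so fewer than
  \<open>2 ^ k\<close> sets are shattered with \<open>k\<close> a small multiple of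
  \<open>card F\<close>; and then the sum of the \<open>card F choose j\<close> over
  \<open>j < k\<close> is small. The constant \<open>\<delta>\<close> precedes the quantifiers, so
  that one value serves all \<open>F\<close>, \<open>A\<close> and \<open>Y\<close>.\<close>

lemma disambiguation_exp:
  assumes "\<epsilon> > (0::real)"
  obtains \<delta> where "\<delta> > 0"
    "\<forall>(F :: 'i set) (A :: 'i \<Rightarrow> bool \<Rightarrow> 'x set) Y.
       finite F \<and> (\<forall>i\<in>F. A i True \<inter> A i False = {}) \<and>
       (\<forall>J\<subseteq>F. shatters A Y J \<longrightarrow> real (card J) \<le> \<delta> * real (card F))
      \<longrightarrow> (\<exists>S. finite S \<and> real (card S) \<le> exp (\<epsilon> * real (card F)) \<and>
            (\<forall>x\<in>Y. \<exists>\<sigma>\<in>S. \<forall>i\<in>F. x \<notin> A i (\<not> \<sigma> i)))"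
proof -
  obtain \<delta>' where \<delta>': "\<delta>' > 0"
    "\<And>n. real (\<Sum>j | j \<le> n \<and> real j \<le> \<delta>' * real n. n choose j) \<le> exp (\<epsilon> * real n)"
    by (rule sum_choose_le_exp[OF assms]) (rule that)
  \<comment> \<open>With this rate the number of shattered sets is at most
    \<open>2 powr (\<delta>' * card F)\<close>.\<close>
  have pos: "\<delta>' * ln 2 > 0" using \<delta>'(1) by simp
  obtain \<delta> where \<delta>: "\<delta> > 0"
    "\<And>n. real (\<Sum>j | j \<le> n \<and> real j \<le> \<delta> * real n. n choose j) \<le> exp (\<delta>' * ln 2 * real n)"
    by (rule sum_choose_le_exp[OF pos]) (rule that)
  show ?thesis
  proof (rule that[OF \<delta>(1)], intro allI impI)
    fix F :: "'i set" and A :: "'i \<Rightarrow> bool \<Rightarrow> 'x set" and Y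
    assume "finite F \<and> (\<forall>i\<in>F. A i True \<inter> A i False = {}) \<and>
       (\<forall>J\<subseteq>F. shatters A Y J \<longrightarrow> real (card J) \<le> \<delta> * real (card F))"
    then have F: "finite F" and disj: "\<forall>i\<in>F. A i True \<inter> A i False = {}"
      and small: "\<forall>J\<subseteq>F. shatters A Y J \<longrightarrow> real (card J) \<le> \<delta> * real (card F)"
      by auto
    \<comment> \<open>The least integer above \<open>\<delta>' * card F\<close>: the count of
      shattered sets is then strictly below \<open>2 ^ k\<close>, while each \<open>j < k\<close>
      still satisfies \<open>j \<le> \<delta>' * card F\<close>.\<close>
    define k where "k = Suc (nat \<lfloor>\<delta>' * real (card F)\<rfloor>)"
    have nonneg: "0 \<le> \<delta>' * real (card F)" using \<delta>'(1) by simp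
    have k: "\<delta>' * real (card F) < real k"
      unfolding k_def using nonneg by linarith
    have k': "real j \<le> \<delta>' * real (card F)" if "j < k" for j
      using that nonneg unfolding k_def by linarith
    have "card {J. J \<subseteq> F \<and> shatters A Y J} \<le> card {J. J \<subseteq> F \<and> real (card J) \<le> \<delta> * real (card F)}"
      using F small by (intro card_mono) auto
    also note card_subsets_le[OF F]
    finally have "real (card {J. J \<subseteq> F \<and> shatters A Y J}) \<le>
        real (\<Sum>j | j \<le> card F \<and> real j \<le> \<delta> * real (card F). card F choose j)"
      by linarith
    also have "\<dots> \<le> exp (\<delta>' * ln 2 * real (card F))" by (rule \<delta>(2))
    also have "\<dots> = 2 powr (\<delta>' * real (card F))" by (simp add: powr_def mult_ac)
    also have "\<dots> < 2 powr real k" using k by simp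
    also have "\<dots> = real (2 ^ k)" by (simp add: powr_realpow)
    finally have "card {J. J \<subseteq> F \<and> shatters A Y J} < 2 ^ k" by (simp only: of_nat_less_iff)
    then obtain S where S: "finite S" "card S \<le> (\<Sum>j<k. card F choose j)"
        "\<forall>x\<in>Y. \<exists>\<sigma>\<in>S. \<forall>i\<in>F. x \<notin> A i (\<not> \<sigma> i)"
      using disambiguation[of F A Y k, OF F disj] by blast
    \<comment> \<open>Binomial coefficients with \<open>j > card F\<close> vanish.\<close>
    have "(\<Sum>j<k. card F choose j) = (\<Sum>j | j < k \<and> j \<le> card F. card F choose j)"
      by (rule sum.mono_neutral_right) (auto simp: not_le)
    also have "\<dots> \<le> (\<Sum>j | j \<le> card F \<and> real j \<le> \<delta>' * real (card F). card F choose j)"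
      using k' by (intro sum_mono2) auto
    finally have "real (card S) \<le> real (\<Sum>j | j \<le> card F \<and> real j \<le> \<delta>' * real (card F). card F choose j)"
      using S(2) by linarith
    also have "\<dots> \<le> exp (\<epsilon> * real (card F))" by (rule \<delta>'(2))
    finally show "\<exists>S. finite S \<and> real (card S) \<le> exp (\<epsilon> * real (card F)) \<and>
            (\<forall>x\<in>Y. \<exists>\<sigma>\<in>S. \<forall>i\<in>F. x \<notin> A i (\<not> \<sigma> i))"
      using S by blast
  qed
qed

section \<open>Covers\<close>

lemma finite_Cover_Join:
  assumes "finite F" "\<And>s. s \<in> F \<Longrightarrow> finite (\<W> s)"
  shows "finite (Cover_Join F \<W>)"
  using assms
proof (induction F rule: finite_induct)
  case empty
  \<comment> \<open>The intersection over the empty index set is \<open>UNIV\<close>.\<close>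
  have "Cover_Join {} \<W> \<subseteq> {UNIV}" by (auto simp: Cover_Join_def)
  then show ?case by (rule finite_subset) simp
next
  case (insert s F)
  have "cover_join (\<W> s) (Cover_Join F \<W>) = (\<lambda>(U, V). U \<inter> V) ` (\<W> s \<times> Cover_Join F \<W>)"
    by (auto simp: cover_join_def)
  then show ?case using insert by (simp add: Cover_Join_insert)
qed

lemma Union_Cover_Join:
  assumes "F \<noteq> {}" "\<And>s. s \<in> F \<Longrightarrow> \<Union>(\<W> s) = T"
  shows "\<Union>(Cover_Join F \<W>) = T"
proof
  show "\<Union>(Cover_Join F \<W>) \<subseteq> T"
    using assms unfolding Cover_Join_def by fast
  show "T \<subseteq> \<Union>(Cover_Join F \<W>)"
  proof
    fix x assume "x \<in> T"
    then have "\<forall>s\<in>F. \<exists>W. W \<in> \<W> s \<and> x \<in> W" using assms(2) by blast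
    then obtain W where "\<forall>s\<in>F. W s \<in> \<W> s \<and> x \<in> W s" by metis
    then show "x \<in> \<Union>(Cover_Join F \<W>)"
      unfolding Cover_Join_def by blast
  qed
qed

lemma min_subcover_card_le:
  assumes "\<V> \<subseteq> \<U>" "finite \<V>" "\<Union>\<V> = topspace X"
  shows "min_subcover_card X \<U> \<le> card \<V>"
  unfolding min_subcover_card_def using assms by (intro Least_le) blast

lemma min_subcover_card_attained:
  assumes "finite \<U>" "\<Union>\<U> = topspace X"
  obtains \<V> where "\<V> \<subseteq> \<U>" "finite \<V>" "\<Union>\<V> = topspace X" "card \<V> = min_subcover_card X \<U>"
proof -
  have "\<exists>\<V>. \<V> \<subseteq> \<U> \<and> finite \<V> \<and> \<Union>\<V> = topspace X \<and> card \<V> = min_subcover_card X \<U>"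
    unfolding min_subcover_card_def
    by (rule LeastI_ex) (use assms in blast)
  then show ?thesis using that by blast
qed

text \<open>Regularity puts a closed neighbourhood of each point inside a member of the cover, and
  compactness leaves finitely many. Pairs are recorded because \<open>C\<close> and the complement
  of \<open>U\<close> will form a disjoint closed tuple.\<close>

lemma closed_in_open_cover:
  assumes "compact_space X" "regular_space X" "finite_open_cover X \<U>"
  obtains P where "finite P" "\<And>C U. (C, U) \<in> P \<Longrightarrow> closedin X C \<and> U \<in> \<U> \<and> C \<subseteq> U"
    "\<Union>(fst ` P) = topspace X"
proof -
  have "\<exists>V C U. openin X V \<and> closedin X C \<and> U \<in> \<U> \<and> x \<in> V \<and> V \<subseteq> C \<and> C \<subseteq> U"
    if x: "x \<in> topspace X" for x
  proof -
    obtain U where U: "U \<in> \<U>" "x \<in> U" "openin X U"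
      using x assms(3) unfolding finite_open_cover_def by blast
    then obtain V C where "openin X V" "closedin X C" "x \<in> V" "V \<subseteq> C" "C \<subseteq> U"
      using assms(2) unfolding neighbourhood_base_of_closedin[symmetric] neighbourhood_base_of
      by meson
    then show ?thesis using U by blast
  qed
  then obtain V C U where VCU: "\<And>x. x \<in> topspace X \<Longrightarrow>
      openin X (V x) \<and> closedin X (C x) \<and> U x \<in> \<U> \<and> x \<in> V x \<and> V x \<subseteq> C x \<and> C x \<subseteq> U x"
    by metis
  have "\<forall>W\<in>V ` topspace X. openin X W" "topspace X \<subseteq> \<Union>(V ` topspace X)"
    using VCU by auto
  then obtain \<F> where "finite \<F>" "\<F> \<subseteq> V ` topspace X" "topspace X \<subseteq> \<Union>\<F>"
    using assms(1)[unfolded compact_space_alt, rule_format, of "V ` topspace X"] by blast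
  then obtain D where D: "finite D" "D \<subseteq> topspace X" "topspace X \<subseteq> \<Union>(V ` D)"
    by (metis finite_subset_image)
  show ?thesis
  proof (rule that[of "(\<lambda>x. (C x, U x)) ` D"])
    show "finite ((\<lambda>x. (C x, U x)) ` D)" using D(1) by simp
    show "closedin X C' \<and> U' \<in> \<U> \<and> C' \<subseteq> U'" if "(C', U') \<in> (\<lambda>x. (C x, U x)) ` D" for C' U'
      using that VCU D(2) by blast
    have "\<Union>(C ` D) = topspace X"
    proof
      have "C x \<subseteq> topspace X" if "x \<in> D" for x
        using VCU[of x] D(2) that by (blast dest: closedin_subset)
      then show "\<Union>(C ` D) \<subseteq> topspace X" by blast
      have "V x \<subseteq> C x" if "x \<in> D" for x
        using VCU[of x] D(2) that by blast
      then show "topspace X \<subseteq> \<Union>(C ` D)" using D(3) by blast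
    qed
    then show "\<Union>(fst ` (\<lambda>x. (C x, U x)) ` D) = topspace X" by (simp add: image_image)
  qed
qed

section \<open>Entropy and independence\<close>

context
  fixes G :: "('g, 'b) monoid_scheme" and X :: "'x topology" and \<phi> :: "'g \<Rightarrow> 'x \<Rightarrow> 'x"
  assumes act: "group_action G (topspace X) \<phi>"
begin

section \<open>Inverse translates and iterated covers\<close>

lemma inv_carrier: "s \<in> carrier G \<Longrightarrow> inv\<^bsub>G\<^esub> s \<in> carrier G"
  using act by (simp add: group.inv_closed group_action_def group_hom_def)

lemma inv_translate_topspace: "s \<in> carrier G \<Longrightarrow> inv_translate G \<phi> s (topspace X) = topspace X"
  unfolding inv_translate_def by (intro group_action.surj_prop[OF act] inv_carrier)

lemma inv_translate_mono: "A \<subseteq> B \<Longrightarrow> inv_translate G \<phi> s A \<subseteq> inv_translate G \<phi> s B"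
  unfolding inv_translate_def by blast

lemma inv_translate_disjoint:
  assumes "s \<in> carrier G" "A \<subseteq> topspace X" "B \<subseteq> topspace X" "A \<inter> B = {}"
  shows "inv_translate G \<phi> s A \<inter> inv_translate G \<phi> s B = {}"
  using assms inj_on_image_Int[OF group_action.inj_prop[OF act inv_carrier[OF assms(1)]] assms(2,3)]
  unfolding inv_translate_def by simp

lemma inv_translate_Diff:
  assumes "s \<in> carrier G" "A \<subseteq> topspace X"
  shows "inv_translate G \<phi> s (topspace X - A) = topspace X - inv_translate G \<phi> s A"
  using assms inv_translate_topspace[OF assms(1)]
    inj_on_image_set_diff[OF group_action.inj_prop[OF act inv_carrier[OF assms(1)]], of "topspace X" A]
  unfolding inv_translate_def by auto

lemma Union_inv_translate:
  "s \<in> carrier G \<Longrightarrow> \<Union>\<U> = topspace X \<Longrightarrow> \<Union>(inv_translate G \<phi> s ` \<U>) = topspace X"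
  using inv_translate_topspace[of s] unfolding inv_translate_def by (metis image_Union)

lemma Union_iterated_cover:
  assumes "F \<subseteq> carrier G" "F \<noteq> {}" "\<Union>\<U> = topspace X"
  shows "\<Union>(iterated_cover G \<phi> \<U> F) = topspace X"
  unfolding iterated_cover_def
  by (intro Union_Cover_Join Union_inv_translate) (use assms in auto)

lemma iterated_cover_memE:
  assumes "V \<in> iterated_cover G \<phi> \<U> F"
  obtains W where "\<And>s. s \<in> F \<Longrightarrow> W s \<in> \<U>" "V = (\<Inter>s\<in>F. inv_translate G \<phi> s (W s))"
proof -
  obtain W' where W': "\<forall>s\<in>F. W' s \<in> inv_translate G \<phi> s ` \<U>" "V = (\<Inter>s\<in>F. W' s)"
    using assms unfolding iterated_cover_def Cover_Join_def by blast
  then have "\<forall>s\<in>F. \<exists>U. U \<in> \<U> \<and> W' s = inv_translate G \<phi> s U" by blast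
  then obtain W where W: "\<forall>s\<in>F. W s \<in> \<U> \<and> W' s = inv_translate G \<phi> s (W s)"
    by (rule bchoice[THEN exE])
  show ?thesis by (rule that[of W]) (use W W'(2) in auto)
qed

lemma iterated_cover_memI:
  assumes "\<And>s. s \<in> F \<Longrightarrow> W s \<in> \<U>"
  shows "(\<Inter>s\<in>F. inv_translate G \<phi> s (W s)) \<in> iterated_cover G \<phi> \<U> F"
  using assms unfolding iterated_cover_def Cover_Join_def
  by (intro CollectI exI[of _ "\<lambda>s. inv_translate G \<phi> s (W s)"]) auto

text \<open>If no member of the cover meets both entries of a pair, then a member of the iterated cover contains
  at most one of the \<open>2 ^ card J\<close> points witnessing the independence of \<open>J\<close>.\<close>

lemma min_subcover_card_ge:
  assumes F: "F \<subseteq> carrier G" "finite F"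
    and J: "J \<subseteq> F" "J \<noteq> {}" "independence_set G \<phi> A J" and A: "length A \<ge> 2"
    and At: "\<And>b. b < 2 \<Longrightarrow> A ! b \<subseteq> topspace X"
    and \<U>: "finite \<U>" "\<Union>\<U> = topspace X"
    and sep: "\<And>U. U \<in> \<U> \<Longrightarrow> \<exists>b<2. U \<inter> A ! b = {}"
  shows "2 ^ card J \<le> min_subcover_card X (iterated_cover G \<phi> \<U> F)"
proof -
  have "F \<noteq> {}" using J by blast
  then have "finite (iterated_cover G \<phi> \<U> F)" "\<Union>(iterated_cover G \<phi> \<U> F) = topspace X"
    using Union_iterated_cover[OF F(1) _ \<U>(2)] F(2) \<U>(1)
    by (auto simp: iterated_cover_def intro!: finite_Cover_Join)
  then obtain \<V> where \<V>: "\<V> \<subseteq> iterated_cover G \<phi> \<U> F" "finite \<V>" "\<Union>\<V> = topspace X"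
    "card \<V> = min_subcover_card X (iterated_cover G \<phi> \<U> F)"
    by (rule min_subcover_card_attained)
  have finJ: "finite J" using F(2) J(1) finite_subset by blast
  \<comment> \<open>Only the first two entries of the tuple are used. The patterns are extensional,
    so that there are exactly \<open>2 ^ card J\<close> of them.\<close>
  have "\<exists>V x. V \<in> \<V> \<and> x \<in> V \<and> x \<in> (\<Inter>s\<in>J. inv_translate G \<phi> s (A ! \<omega> s))"
    if \<omega>: "\<omega> \<in> J \<rightarrow>\<^sub>E {..<2}" for \<omega> :: "'g \<Rightarrow> nat"
  proof -
    have "\<omega> \<in> J \<rightarrow> {..<length A}"
    proof
      fix s assume "s \<in> J"
      then have "\<omega> s < 2" using \<omega> by (metis PiE_mem lessThan_iff)
      then show "\<omega> s \<in> {..<length A}" using A by simp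
    qed
    then have "(\<Inter>s\<in>J. inv_translate G \<phi> s (A ! \<omega> s)) \<noteq> {}"
      using J(3)[unfolded independence_set_def, THEN conjunct2, rule_format, of J \<omega>] J(2) finJ by simp
    then obtain x where x: "x \<in> (\<Inter>s\<in>J. inv_translate G \<phi> s (A ! \<omega> s))" by blast
    obtain s where s: "s \<in> J" using J(2) by blast
    then have "A ! \<omega> s \<subseteq> topspace X" using At \<omega> by (metis PiE_mem lessThan_iff)
    then have "x \<in> topspace X"
      using x s F(1) J(1) inv_translate_mono[of "A ! \<omega> s" "topspace X" s] inv_translate_topspace[of s] by blast
    then show ?thesis using \<V>(3) x by blast
  qed
  then obtain V x where Vx: "\<And>\<omega>. \<omega> \<in> J \<rightarrow>\<^sub>E {..<2::nat} \<Longrightarrow>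
      V \<omega> \<in> \<V> \<and> x \<omega> \<in> V \<omega> \<and> x \<omega> \<in> (\<Inter>s\<in>J. inv_translate G \<phi> s (A ! \<omega> s))"
    by metis
  have "inj_on V (J \<rightarrow>\<^sub>E {..<2})"
  proof (rule inj_onI)
    fix \<omega> \<omega>' assume \<omega>: "\<omega> \<in> J \<rightarrow>\<^sub>E {..<2}" "\<omega>' \<in> J \<rightarrow>\<^sub>E {..<2}" "V \<omega> = V \<omega>'"
    have "V \<omega> \<in> iterated_cover G \<phi> \<U> F" using \<V>(1) Vx[OF \<omega>(1)] by blast
    then obtain W where W: "\<And>s. s \<in> F \<Longrightarrow> W s \<in> \<U>" "V \<omega> = (\<Inter>s\<in>F. inv_translate G \<phi> s (W s))"
      by (rule iterated_cover_memE) blast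
    show "\<omega> = \<omega>'"
    proof (rule PiE_ext[OF \<omega>(1,2)])
      fix s assume s: "s \<in> J"
      then have sF: "s \<in> F" "s \<in> carrier G" using J(1) F(1) by auto
      \<comment> \<open>Since \<open>W s\<close> misses entry \<open>b\<close>, neither pattern
        takes the value \<open>b\<close> at \<open>s\<close>; just one of the two values
        remains.\<close>
      obtain b where b: "b < 2" "W s \<inter> A ! b = {}" using sep W(1)[OF sF(1)] by blast
      have "W s \<subseteq> topspace X" using W(1)[OF sF(1)] \<U>(2) by blast
      then have "inv_translate G \<phi> s (W s) \<inter> inv_translate G \<phi> s (A ! b) = {}"
        using b At sF(2) by (intro inv_translate_disjoint)
      moreover have "x \<omega> \<in> inv_translate G \<phi> s (W s) \<inter> inv_translate G \<phi> s (A ! \<omega> s)"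
        using Vx[OF \<omega>(1)] W(2) s sF by auto
      moreover have "x \<omega>' \<in> inv_translate G \<phi> s (W s) \<inter> inv_translate G \<phi> s (A ! \<omega>' s)"
        using Vx[OF \<omega>(2)] W(2) \<omega>(3) s sF by auto
      ultimately have "\<omega> s \<noteq> b" "\<omega>' s \<noteq> b" by auto
      moreover have "\<omega> s < 2" "\<omega>' s < 2" using \<omega>(1,2) s by (auto dest!: PiE_mem)
      ultimately show "\<omega> s = \<omega>' s" using b(1) by linarith
    qed
  qed
  then have "card (J \<rightarrow>\<^sub>E {..<2::nat}) \<le> card \<V>"
    using Vx \<V>(2) by (intro card_inj_on_le[of V]) auto
  then show ?thesis using \<V>(4) finJ by (simp add: card_PiE)
qed

section \<open>From positive density to positive entropy\<close>

text \<open>The tuple that supplies an independence set varies with \<open>F\<close>, so one cover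
  must separate the first two entries of every tuple. If the density is \<open>q\<close>, its
  entropy is at least \<open>q * ln 2\<close>.\<close>

lemma naive_entropy_pos_if_independence_density_pos:
  assumes "\<A> \<subseteq> set_tuples_ge X 2" "finite \<A>" "pairwise_disjoint_family \<A>" "closed_family X \<A>"
    and "independence_density G \<phi> \<A> > 0"
  shows "naive_entropy G X \<phi> > 0"
proof -
  define q where "q = independence_density G \<phi> \<A>"
  have q: "q > 0" using assms(5) q_def by simp
  have ne: "\<A> \<noteq> {}" using assms(5) by (auto simp: independence_density_def)
  have grp: "group G" using act by (simp add: group_action_def group_hom_def)
  have dens: "density_bound G \<phi> \<A> q" unfolding q_def by (rule independence_density_greatest(1)[OF grp ne])
  have len: "length A \<ge> 2" if "A \<in> \<A>" for A
    using that assms(1) by (auto simp: set_tuples_ge_def set_tuples_def)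
  have cl: "closedin X (A ! b)" if "A \<in> \<A>" "b < 2" for A b
    using that assms(4) len[of A] by (auto simp: closed_family_def)
  \<comment> \<open>The sets \<open>U \<sigma>\<close> form the join, over all tuples of the family,
    of the two-element covers by complements of the first two entries.\<close>
  define U where "U \<sigma> = topspace X - (\<Union>A\<in>\<A>. A ! \<sigma> A)" for \<sigma>
  define \<U> where "\<U> = U ` (\<A> \<rightarrow>\<^sub>E {..<2::nat})"
  have \<sigma>2: "\<sigma> A < 2" if "\<sigma> \<in> \<A> \<rightarrow>\<^sub>E {..<2::nat}" "A \<in> \<A>" for \<sigma> A
    using that by (auto dest!: PiE_mem)
  have cover: "finite_open_cover X \<U>"
    unfolding finite_open_cover_def
  proof (intro conjI ballI)
    show "finite \<U>" unfolding \<U>_def using assms(2) by (intro finite_imageI finite_PiE) auto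
    show "openin X V" if V: "V \<in> \<U>" for V
    proof -
      obtain \<sigma> where \<sigma>: "\<sigma> \<in> \<A> \<rightarrow>\<^sub>E {..<2::nat}" "V = U \<sigma>" using V unfolding \<U>_def by blast
      have "closedin X (\<Union>A\<in>\<A>. A ! \<sigma> A)"
        using assms(2) cl \<sigma>2[OF \<sigma>(1)] by (intro closedin_Union) auto
      then show ?thesis using \<sigma>(2) by (simp add: U_def openin_diff)
    qed
    show "\<Union>\<U> = topspace X"
    proof
      show "\<Union>\<U> \<subseteq> topspace X" by (auto simp: \<U>_def U_def)
      show "topspace X \<subseteq> \<Union>\<U>"
      proof
        fix x assume x: "x \<in> topspace X"
        have "\<exists>b<2. x \<notin> A ! b" if "A \<in> \<A>" for A
        proof -
          have "disjoint_family_on (\<lambda>i. A ! i) {..<length A}"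
            using that assms(3) by (simp add: pairwise_disjoint_family_def)
          then have "A ! 0 \<inter> A ! 1 = {}"
            by (rule disjoint_family_onD) (use len[OF that] in auto)
          then consider "x \<notin> A ! 0" | "x \<notin> A ! 1" by blast
          then show ?thesis by cases (auto intro: exI[of _ 0] exI[of _ 1])
        qed
        then obtain \<sigma> where \<sigma>: "\<And>A. A \<in> \<A> \<Longrightarrow> \<sigma> A < (2::nat) \<and> x \<notin> A ! \<sigma> A" by metis
        have "x \<in> U (restrict \<sigma> \<A>)" using x \<sigma> by (auto simp: U_def)
        moreover have "restrict \<sigma> \<A> \<in> \<A> \<rightarrow>\<^sub>E {..<2}" using \<sigma> by auto
        ultimately show "x \<in> \<Union>\<U>" unfolding \<U>_def by blast
      qed
    qed
  qed
  have "ereal (q * ln 2) \<le> naive_entropy_cover G X \<phi> \<U>"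
    unfolding naive_entropy_cover_def
  proof (rule INF_greatest)
    fix F assume "F \<in> {F. F \<subseteq> carrier G \<and> finite F \<and> F \<noteq> {}}"
    then have F: "F \<subseteq> carrier G" "finite F" "F \<noteq> {}" by auto
    then obtain J A where J: "J \<subseteq> F" "real (card J) \<ge> q * real (card F)" "A \<in> \<A>"
      "independence_set G \<phi> A J"
      using dens unfolding density_bound_def by meson
    have cF: "real (card F) > 0" using F by (simp add: card_gt_0_iff)
    then have "real (card J) > 0" using q J(2) by (smt (verit) mult_pos_pos)
    then have "J \<noteq> {}" by auto
    have "2 ^ card J \<le> min_subcover_card X (iterated_cover G \<phi> \<U> F)"
    proof (rule min_subcover_card_ge[OF F(1,2) J(1) \<open>J \<noteq> {}\<close> J(4) len[OF J(3)]])
      show "A ! b \<subseteq> topspace X" if "b < 2" for b using cl[OF J(3) that] by (rule closedin_subset)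
      show "finite \<U>" "\<Union>\<U> = topspace X" using cover by (auto simp: finite_open_cover_def)
      show "\<exists>b<2. V \<inter> A ! b = {}" if V: "V \<in> \<U>" for V
      proof -
        obtain \<sigma> where \<sigma>: "\<sigma> \<in> \<A> \<rightarrow>\<^sub>E {..<2::nat}" "V = U \<sigma>" using V unfolding \<U>_def by blast
        have "V \<inter> A ! \<sigma> A = {}" using J(3) \<sigma>(2) by (auto simp: U_def)
        then show ?thesis using \<sigma>2[OF \<sigma>(1) J(3)] by blast
      qed
    qed
    then have "real (2 ^ card J) \<le> real (min_subcover_card X (iterated_cover G \<phi> \<U> F))"
      by (rule of_nat_mono)
    then have "ln (real (2 ^ card J)) \<le> ln (real (min_subcover_card X (iterated_cover G \<phi> \<U> F)))"
      by (intro ln_mono) auto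
    moreover have "ln (real (2 ^ card J)) = real (card J) * ln 2" by (simp add: ln_realpow)
    moreover have "q * ln 2 * real (card F) \<le> real (card J) * ln 2"
      using mult_right_mono[OF J(2), of "ln 2"] by (simp add: mult_ac)
    ultimately have "q * ln 2 * real (card F) \<le> ln (real (min_subcover_card X (iterated_cover G \<phi> \<U> F)))"
      by linarith
    then show "ereal (q * ln 2) \<le>
        ereal (1 / real (card F) * ln (real (min_subcover_card X (iterated_cover G \<phi> \<U> F))))"
      using cF by (simp add: field_simps)
  qed
  also have "\<dots> \<le> naive_entropy G X \<phi>"
    unfolding naive_entropy_def using cover by (intro SUP_upper) auto
  finally have "ereal (q * ln 2) \<le> naive_entropy G X \<phi>" .
  moreover have "0 < ereal (q * ln 2)" using q by simp
  ultimately show ?thesis by (rule less_le_trans[rotated])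
qed

section \<open>From positive entropy to positive density\<close>

text \<open>For \<open>p = (C, U)\<close> with \<open>C \<subseteq> U\<close>, a point in the
  translate of \<open>U - C\<close> has no value at \<open>s\<close>; this is where partial
  functions come from.\<close>

definition translates :: "'x set \<times> 'x set \<Rightarrow> 'g \<Rightarrow> bool \<Rightarrow> 'x set"
  where "translates p s b = inv_translate G \<phi> s (if b then fst p else topspace X - snd p)"

text \<open>\<open>True\<close> corresponds to entry 0 and \<open>False\<close> to entry 1. A point
  realizing a pattern on all of \<open>J\<close> serves every finite subset of
  \<open>J\<close>.\<close>

lemma independence_set_if_shatters:
  assumes "J \<subseteq> carrier G" "shatters (translates p) Y J"
  shows "independence_set G \<phi> [fst p, topspace X - snd p] J"
  unfolding independence_set_def
proof (intro conjI allI impI)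
  fix F and \<omega> :: "'g \<Rightarrow> nat"
  let ?A = "[fst p, topspace X - snd p]"
  assume F: "finite F \<and> F \<noteq> {} \<and> F \<subseteq> J \<and> \<omega> \<in> F \<rightarrow> {..<length ?A}"
  obtain x where x: "\<forall>s\<in>J. x \<in> translates p s (\<omega> s = 0)"
    using assms(2)[unfolded shatters_def, rule_format, of "\<lambda>s. \<omega> s = 0"] by blast
  have "x \<in> inv_translate G \<phi> s (?A ! \<omega> s)" if s: "s \<in> F" for s
  proof -
    have "\<omega> \<in> F \<rightarrow> {..<2}" using F by (simp add: numeral_2_eq_2)
    then have "\<omega> s < 2" using s by blast
    then have "\<omega> s = 0 \<or> \<omega> s = 1" by linarith
    moreover have "x \<in> translates p s (\<omega> s = 0)" using x F s by blast
    ultimately show ?thesis by (auto simp: translates_def)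
  qed
  then show "(\<Inter>s\<in>F. inv_translate G \<phi> s (?A ! \<omega> s)) \<noteq> {}" by blast
qed (use assms in simp)

text \<open>A function in \<open>S p\<close> extending \<open>x\<close> tells for each \<open>s\<close> whether \<open>x\<close> lies in the translate of
  \<open>snd p\<close> or avoids that of \<open>fst p\<close>; the latter cannot happen for all \<open>p\<close>. So a choice of one function
  for each \<open>p\<close> yields a member of the iterated cover containing \<open>x\<close>.\<close>

lemma min_subcover_card_le_prod:
  assumes F: "F \<subseteq> carrier G" "finite F" "F \<noteq> {}"
    and P: "finite P" "\<And>p. p \<in> P \<Longrightarrow> snd p \<in> \<U>" "\<Union>(fst ` P) = topspace X"
    and \<U>: "\<Union>\<U> = topspace X"
    and S: "\<And>p. p \<in> P \<Longrightarrow> finite (S p)"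
    "\<And>p x. p \<in> P \<Longrightarrow> x \<in> topspace X \<Longrightarrow> \<exists>\<sigma>\<in>S p. \<forall>s\<in>F. x \<notin> translates p s (\<not> \<sigma> s)"
  shows "min_subcover_card X (iterated_cover G \<phi> \<U> F) \<le> (\<Prod>p\<in>P. card (S p))"
proof -
  \<comment> \<open>Only choices with the value \<open>True\<close> for some \<open>p\<close> at
    every \<open>s\<close> determine a member of the iterated cover; \<open>c\<close> picks such a
    \<open>p\<close>.\<close>
  define \<Sigma> where "\<Sigma> = {g \<in> PiE P S. \<forall>s\<in>F. \<exists>p\<in>P. g p s}"
  define c where "c g s = (SOME p. p \<in> P \<and> g p s)" for g :: "'x set \<times> 'x set \<Rightarrow> 'g \<Rightarrow> bool" and s
  define V where "V g = (\<Inter>s\<in>F. inv_translate G \<phi> s (snd (c g s)))" for g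
  have c: "c g s \<in> P \<and> g (c g s) s" if "g \<in> \<Sigma>" "s \<in> F" for g s
    unfolding c_def by (rule someI_ex) (use that in \<open>unfold \<Sigma>_def, blast\<close>)
  have finPi: "finite (PiE P S)" using P(1) S(1) by (intro finite_PiE)
  have fin: "finite \<Sigma>" unfolding \<Sigma>_def using finPi by simp
  have "V g \<in> iterated_cover G \<phi> \<U> F" if "g \<in> \<Sigma>" for g
    unfolding V_def using c[OF that] P(2) by (intro iterated_cover_memI) simp
  then have sub: "V ` \<Sigma> \<subseteq> iterated_cover G \<phi> \<U> F" by blast
  have un: "\<Union>(V ` \<Sigma>) = topspace X"
  proof
    show "\<Union>(V ` \<Sigma>) \<subseteq> topspace X"
      using Union_iterated_cover[OF F(1,3) \<U>] sub by blast
    show "topspace X \<subseteq> \<Union>(V ` \<Sigma>)"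
    proof
      fix x assume x: "x \<in> topspace X"
      then have "\<forall>p\<in>P. \<exists>\<sigma>. \<sigma> \<in> S p \<and> (\<forall>s\<in>F. x \<notin> translates p s (\<not> \<sigma> s))"
        using S(2) by blast
      then obtain g0 where g0: "\<forall>p\<in>P. g0 p \<in> S p \<and> (\<forall>s\<in>F. x \<notin> translates p s (\<not> g0 p s))"
        by (rule bchoice[THEN exE])
      define g where "g = restrict g0 P"
      have g: "g \<in> PiE P S" "\<And>p s. p \<in> P \<Longrightarrow> s \<in> F \<Longrightarrow> x \<notin> translates p s (\<not> g p s)"
        using g0 by (auto simp: g_def)
      have "\<exists>p\<in>P. g p s" if s: "s \<in> F" for s
      proof (rule ccontr)
        assume "\<not> (\<exists>p\<in>P. g p s)"
        then have "x \<notin> inv_translate G \<phi> s (fst p)" if "p \<in> P" for p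
          using g(2)[OF that s] that by (simp add: translates_def)
        moreover have "\<Union>(inv_translate G \<phi> s ` fst ` P) = topspace X"
          using F(1) s P(3) by (intro Union_inv_translate) auto
        ultimately show False using x by blast
      qed
      then have g\<Sigma>: "g \<in> \<Sigma>" using g(1) by (simp add: \<Sigma>_def)
      have "x \<in> V g"
        unfolding V_def
      proof
        fix s assume s: "s \<in> F"
        have cs: "c g s \<in> P" "g (c g s) s" using c[OF g\<Sigma> s] by auto
        then have "x \<notin> inv_translate G \<phi> s (topspace X - snd (c g s))"
          using g(2)[OF cs(1) s] by (simp add: translates_def)
        moreover have "snd (c g s) \<subseteq> topspace X" using P(2) cs(1) \<U> by blast
        ultimately show "x \<in> inv_translate G \<phi> s (snd (c g s))"
          using x F(1) s by (simp add: inv_translate_Diff subset_iff)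
      qed
      then show "x \<in> \<Union>(V ` \<Sigma>)" using g\<Sigma> by blast
    qed
  qed
  have "min_subcover_card X (iterated_cover G \<phi> \<U> F) \<le> card (V ` \<Sigma>)"
    using sub fin un by (intro min_subcover_card_le) auto
  also have "\<dots> \<le> card \<Sigma>" using fin by (rule card_image_le)
  also have "\<dots> \<le> card (PiE P S)" using finPi by (intro card_mono) (auto simp: \<Sigma>_def)
  also have "\<dots> = (\<Prod>p\<in>P. card (S p))" using P(1) by (simp add: card_PiE)
  finally show ?thesis .
qed

text \<open>If over some \<open>F\<close> no pair had a large shattered set, each pair would need at
  most \<open>exp (\<epsilon> * card F)\<close> functions, and their product over \<open>P\<close>
  would bound the cover number by an exponential of rate below the entropy. The pair found depends
  on \<open>F\<close>, hence a family.\<close>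

lemma independence_density_pos_if_naive_entropy_pos:
  assumes "compact_space X" "regular_space X" "naive_entropy G X \<phi> > 0"
  obtains \<A> where "\<A> \<subseteq> set_tuples X 2" "finite \<A>" "pairwise_disjoint_family \<A>" "closed_family X \<A>"
    "independence_density G \<phi> \<A> > 0"
proof -
  have grp: "group G" using act by (simp add: group_action_def group_hom_def)
  obtain \<U> where \<U>: "finite_open_cover X \<U>" "naive_entropy_cover G X \<phi> \<U> > 0"
    using assms(3) unfolding naive_entropy_def less_SUP_iff by blast
  obtain c where c: "0 < ereal c" "ereal c < naive_entropy_cover G X \<phi> \<U>"
    using ereal_dense2[OF \<U>(2)] by auto
  have lower: "c * real (card F) \<le> ln (real (min_subcover_card X (iterated_cover G \<phi> \<U> F)))"
    if "F \<subseteq> carrier G" "finite F" "F \<noteq> {}" for F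
  proof -
    have "naive_entropy_cover G X \<phi> \<U> \<le>
        ereal (1 / real (card F) * ln (real (min_subcover_card X (iterated_cover G \<phi> \<U> F))))"
      unfolding naive_entropy_cover_def using that by (intro INF_lower) auto
    then have "c < 1 / real (card F) * ln (real (min_subcover_card X (iterated_cover G \<phi> \<U> F)))"
      using c(2) by (metis less_ereal.simps(1) less_le_trans)
    moreover have "real (card F) > 0" using that by (simp add: card_gt_0_iff)
    ultimately show ?thesis by (simp add: field_simps)
  qed
  obtain P where P: "finite P" "\<And>C U. (C, U) \<in> P \<Longrightarrow> closedin X C \<and> U \<in> \<U> \<and> C \<subseteq> U"
    "\<Union>(fst ` P) = topspace X"
    by (rule closed_in_open_cover[OF assms(1,2) \<U>(1)]) blast
  have P': "closedin X (fst p)" "snd p \<in> \<U>" "fst p \<subseteq> snd p" "closedin X (topspace X - snd p)"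
    if "p \<in> P" for p
    using P(2)[of "fst p" "snd p"] that \<U>(1) by (auto simp: finite_open_cover_def)
  \<comment> \<open>Makes \<open>card P * \<epsilon>\<close> smaller than \<open>c\<close>; adding 1
    keeps the denominator positive for empty \<open>P\<close>.\<close>
  define \<epsilon> where "\<epsilon> = c / (2 * (real (card P) + 1))"
  have \<epsilon>: "\<epsilon> > 0" using c(1) by (simp add: \<epsilon>_def add_nonneg_pos)
  obtain \<delta> where \<delta>: "\<delta> > 0"
    "\<forall>(F :: 'g set) (A :: 'g \<Rightarrow> bool \<Rightarrow> 'x set) Y.
       finite F \<and> (\<forall>i\<in>F. A i True \<inter> A i False = {}) \<and>
       (\<forall>J\<subseteq>F. shatters A Y J \<longrightarrow> real (card J) \<le> \<delta> * real (card F))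
      \<longrightarrow> (\<exists>S. finite S \<and> real (card S) \<le> exp (\<epsilon> * real (card F)) \<and>
            (\<forall>x\<in>Y. \<exists>\<sigma>\<in>S. \<forall>i\<in>F. x \<notin> A i (\<not> \<sigma> i)))"
    by (rule disambiguation_exp[OF \<epsilon>]) (rule that)
  define \<A> where "\<A> = (\<lambda>p. [fst p, topspace X - snd p]) ` P"
  have dens: "density_bound G \<phi> \<A> \<delta>"
    unfolding density_bound_def
  proof (intro conjI allI impI)
    show "\<delta> \<ge> 0" using \<delta>(1) by simp
    fix F assume "F \<subseteq> carrier G \<and> finite F \<and> F \<noteq> {}"
    then have F: "F \<subseteq> carrier G" "finite F" "F \<noteq> {}" by auto
    have "\<exists>p\<in>P. \<exists>J\<subseteq>F. shatters (translates p) (topspace X) J \<and> real (card J) > \<delta> * real (card F)"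
    proof (rule ccontr)
      assume "\<not> ?thesis"
      then have small: "real (card J) \<le> \<delta> * real (card F)"
        if "p \<in> P" "J \<subseteq> F" "shatters (translates p) (topspace X) J" for p J
        using that by (meson not_le)
      have "\<exists>S. finite S \<and> real (card S) \<le> exp (\<epsilon> * real (card F)) \<and>
            (\<forall>x\<in>topspace X. \<exists>\<sigma>\<in>S. \<forall>i\<in>F. x \<notin> translates p i (\<not> \<sigma> i))" if p: "p \<in> P" for p
      proof (rule \<delta>(2)[rule_format], intro conjI ballI allI impI)
        show "translates p i True \<inter> translates p i False = {}" if "i \<in> F" for i
          using F(1) that P'[OF p] unfolding translates_def
          by (simp, intro inv_translate_disjoint) (auto dest: closedin_subset)
      qed (use F(2) small p in auto)
      then obtain S where S: "\<And>p. p \<in> P \<Longrightarrow> finite (S p) \<and> real (card (S p)) \<le> exp (\<epsilon> * real (card F)) \<and>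
            (\<forall>x\<in>topspace X. \<exists>\<sigma>\<in>S p. \<forall>i\<in>F. x \<notin> translates p i (\<not> \<sigma> i))"
        by metis
      let ?N = "min_subcover_card X (iterated_cover G \<phi> \<U> F)"
      have "?N \<le> (\<Prod>p\<in>P. card (S p))"
        using S P'(2) \<U>(1) by (intro min_subcover_card_le_prod F P) (auto simp: finite_open_cover_def)
      then have "real ?N \<le> (\<Prod>p\<in>P. real (card (S p)))" by (metis of_nat_le_iff of_nat_prod)
      also have "\<dots> \<le> (\<Prod>p\<in>P. exp (\<epsilon> * real (card F)))"
        using S by (intro prod_mono) auto
      also have "\<dots> = exp (real (card P) * \<epsilon> * real (card F))"
        by (simp add: exp_of_nat_mult mult.assoc)
      finally have N: "real ?N \<le> exp (real (card P) * \<epsilon> * real (card F))" .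
      have cF: "real (card F) > 0" using F by (simp add: card_gt_0_iff)
      have "ln (real ?N) \<le> real (card P) * \<epsilon> * real (card F)"
      \<comment> \<open>The value 0 belongs to the empty space, where
        \<open>ln 0 = 0\<close>.\<close>
      proof (cases "?N = 0")
        case True
        then show ?thesis using \<epsilon> by simp
      next
        case False
        then show ?thesis using N by (metis exp_gt_zero ln_exp ln_le_cancel_iff of_nat_0_less_iff gr0I)
      qed
      then have "c * real (card F) \<le> real (card P) * \<epsilon> * real (card F)"
        using lower[OF F] by linarith
      then have "c \<le> real (card P) * \<epsilon>" using cF by simp
      moreover have "\<epsilon> * (2 * (real (card P) + 1)) = c"
        using nonzero_eq_divide_eq[of "2 * (real (card P) + 1)" \<epsilon> c] \<epsilon>_def by simp
      ultimately have "real (card P) * \<epsilon> + 2 * \<epsilon> \<le> 0" by (simp add: algebra_simps)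
      then show False using \<epsilon> by (smt (verit) mult_nonneg_nonneg of_nat_0_le_iff)
    qed
    then obtain p J where pJ: "p \<in> P" "J \<subseteq> F" "shatters (translates p) (topspace X) J"
      "real (card J) > \<delta> * real (card F)" by blast
    have "independence_set G \<phi> [fst p, topspace X - snd p] J"
      using pJ F by (intro independence_set_if_shatters) auto
    then show "\<exists>J A. J \<subseteq> F \<and> \<delta> * real (card F) \<le> real (card J) \<and> A \<in> \<A> \<and> independence_set G \<phi> A J"
      using pJ unfolding \<A>_def by (intro exI[of _ J] exI[of _ "[fst p, topspace X - snd p]"]) auto
  qed
  \<comment> \<open>The density bound at a one-element set exhibits a member of the family; an empty
    family would have density 0 by convention.\<close>
  have "{\<one>\<^bsub>G\<^esub>} \<subseteq> carrier G \<and> finite {\<one>\<^bsub>G\<^esub>} \<and> {\<one>\<^bsub>G\<^esub>} \<noteq> {}"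
    using grp by (simp add: group.is_monoid monoid.one_closed)
  then have ne: "\<A> \<noteq> {}" using dens unfolding density_bound_def by blast
  show ?thesis
  proof (rule that)
    show "\<A> \<subseteq> set_tuples X 2"
    proof
      fix A assume "A \<in> \<A>"
      then obtain p where "p \<in> P" "A = [fst p, topspace X - snd p]" by (auto simp: \<A>_def)
      then show "A \<in> set_tuples X 2"
        using P'(1)[of p] closedin_subset by (fastforce simp: set_tuples_def less_2_cases_iff)
    qed
    show "finite \<A>" using P(1) by (simp add: \<A>_def)
    show "pairwise_disjoint_family \<A>"
      using P'(3) by (fastforce simp: \<A>_def pairwise_disjoint_family_def disjoint_family_on_def
          less_2_cases_iff less_Suc_eq)
    show "closed_family X \<A>"
      using P'(1,4) by (auto simp: \<A>_def closed_family_def less_Suc_eq)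
    show "independence_density G \<phi> \<A> > 0"
      using independence_density_greatest(2)[OF grp ne dens] \<delta>(1) by linarith
  qed
qed

end

theorem theorem2p5:
  fixes G :: "('g, 'b) monoid_scheme"
    and X :: "'x topology"
    and \<phi> :: "'g \<Rightarrow> 'x \<Rightarrow> 'x"
  assumes "group G"
    and "countable (carrier G)"
    and "infinite (carrier G)"
    and "compact_space X"
    and "metrizable_space X"
    and "continuous_action G X \<phi>"
  shows "(naive_entropy G X \<phi> > 0 \<longleftrightarrow>
      (\<exists>\<A>. \<A> \<subseteq> set_tuples X 2 \<and> finite \<A> \<and> pairwise_disjoint_family \<A> \<and> closed_family X \<A> \<and>
        independence_density G \<phi> \<A> > 0)) \<and>
    (naive_entropy G X \<phi> > 0 \<longleftrightarrow>
      (\<exists>\<A>. \<A> \<subseteq> set_tuples_ge X 2 \<and> finite \<A> \<and> pairwise_disjoint_family \<A> \<and> closed_family X \<A> \<and>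
        independence_density G \<phi> \<A> > 0))"
proof -
  have act: "group_action G (topspace X) \<phi>"
    using assms(6) by (simp add: continuous_action_def)
  have sub: "set_tuples X 2 \<subseteq> set_tuples_ge X 2"
    by (auto simp: set_tuples_ge_def)
  let ?P = "\<lambda>T. \<exists>\<A>. \<A> \<subseteq> T \<and> finite \<A> \<and> pairwise_disjoint_family \<A> \<and> closed_family X \<A> \<and>
        independence_density G \<phi> \<A> > 0"
  \<comment> \<open>The three implications form a cycle: from entropy to pairs, from pairs to tuples
    of length at least 2, and back to entropy.\<close>
  have "?P (set_tuples X 2)" if "naive_entropy G X \<phi> > 0"
    by (rule independence_density_pos_if_naive_entropy_pos
        [OF act assms(4) metrizable_imp_regular_space[OF assms(5)] that]) blast
  moreover have "?P (set_tuples_ge X 2)" if "?P (set_tuples X 2)"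
    using that subset_trans[OF _ sub] by (elim exE) blast
  moreover have "naive_entropy G X \<phi> > 0" if "?P (set_tuples_ge X 2)"
    using that by (elim exE conjE) (rule naive_entropy_pos_if_independence_density_pos[OF act])
  ultimately show ?thesis by argo
qed

end
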